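(* Let $\beta,\gamma,k>0$ and $n,d\in\mathbb{N}$. Let $P^1,\dots,P^d$ be independent draws from $\mathsf{Beta}(\beta,\beta)$, and let $X\in(\{0,1\}^d)^n$ be a random dataset whose entries $X_i^j$ ($i\in[n]$, $j\in[d]$) are independent conditioned on $P=(P^1,\dots,P^d)$, with $\mathbb{E}[X_i^j\mid P]=P^j$. Let $M:(\{0,1\}^d)^n\to[-1,1]^d$ be a randomized algorithm that is $(1,\beta\gamma k/(nd))$-differentially private, and assume $$\mathbb{E}_{P,X,M}\big[\|M(X)\|_2^2\big]=k \quad\text{and}\quad \mathbb{E}_{P,X,M}\Big[\sum_{j\in[d]} M(X)^j\big(P^j-\tfrac12\big)\Big]\ge \gamma k.$$ Then $n\ge \gamma\beta\sqrt{k}$.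
   Context: A dataset $x=(x_1,\dots,x_n)\in(\{0,1\}^d)^n$ is viewed as an $n\times d$ matrix with rows $x_i$ (individuals) and columns $x^j$; two datasets are neighbors if they differ in at most one row. A randomized algorithm $M:(\{0,1\}^d)^n\to\mathcal{R}$ is $(\varepsilon,\delta)$-differentially private if for every pair of neighboring datasets $x,x'$ and every measurable $R\subseteq\mathcal{R}$, $\Pr[M(x)\in R]\le e^\varepsilon\Pr[M(x')\in R]+\delta$. $\mathsf{Beta}(\alpha,\beta)$ is the distribution on $[0,1]$ with density proportional to $p^{\alpha-1}(1-p)^{\beta-1}$. Superscript $j$ denotes the coordinate (column) index. *)

theory Defs
  imports "HOL-Probability.Probability"
begin

definition beta_measure :: "real \<Rightarrow> real \<Rightarrow> real measure" where
  "beta_measure a b = density lborel (\<lambda>p. ennreal (indicator {0<..<1} p *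
      p powr (a - 1) * (1 - p) powr (b - 1) / Beta a b))"

definition beta_prior :: "real \<Rightarrow> ('d::finite \<Rightarrow> real) measure" where
  "beta_prior b = PiM UNIV (\<lambda>_. beta_measure b b)"

text \<open>Datasets: n x d binary matrices, rows indexed by 'n, columns by 'd.
  Probability of dataset x given P when the entries are independent given P
  with E[X_i^j | P] = P^j (i.e. Bernoulli(P^j)).\<close>
definition data_prob :: "('d \<Rightarrow> real) \<Rightarrow> ('n::finite \<Rightarrow> 'd::finite \<Rightarrow> bool) \<Rightarrow> real" where
  "data_prob P x = (\<Prod>i\<in>UNIV. \<Prod>j\<in>UNIV. (if x i j then P j else 1 - P j))"

definition out_space :: "('d::finite \<Rightarrow> real) measure" where
  "out_space = PiM UNIV (\<lambda>_. restrict_space lborel {-1..1})"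

definition randomized_alg :: "(('n::finite \<Rightarrow> 'd::finite \<Rightarrow> bool) \<Rightarrow> ('d \<Rightarrow> real) measure) \<Rightarrow> bool" where
  "randomized_alg M \<longleftrightarrow> (\<forall>x. prob_space (M x) \<and> sets (M x) = sets out_space \<and> space (M x) = space out_space)"

definition neighbors :: "('n \<Rightarrow> 'd \<Rightarrow> bool) \<Rightarrow> ('n \<Rightarrow> 'd \<Rightarrow> bool) \<Rightarrow> bool" where
  "neighbors x x' \<longleftrightarrow> (\<exists>i. \<forall>i'. i' \<noteq> i \<longrightarrow> x i' = x' i')"

definition differentially_private ::
  "real \<Rightarrow> real \<Rightarrow> (('n \<Rightarrow> 'd \<Rightarrow> bool) \<Rightarrow> 'r measure) \<Rightarrow> bool" where
  "differentially_private \<epsilon> \<delta> M \<longleftrightarrow>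
     (\<forall>x x'. neighbors x x' \<longrightarrow>
        (\<forall>R \<in> sets (M x). measure (M x) R \<le> exp \<epsilon> * measure (M x') R + \<delta>))"

definition joint_expectation ::
  "real \<Rightarrow> (('n::finite \<Rightarrow> 'd::finite \<Rightarrow> bool) \<Rightarrow> ('d \<Rightarrow> real) measure)
     \<Rightarrow> (('d \<Rightarrow> real) \<Rightarrow> ('n \<Rightarrow> 'd \<Rightarrow> bool) \<Rightarrow> ('d \<Rightarrow> real) \<Rightarrow> real) \<Rightarrow> real" where
  "joint_expectation b M f =
     (\<integral>P. (\<Sum>x\<in>UNIV. data_prob P x * (\<integral>y. f P x y \<partial>M x)) \<partial>beta_prior b)"

end

theory Submission
  imports Defs
begin

text \<open>
  Fingerprinting. Since Beta priors are conjugate to Bernoulli data, each fixed dataset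
  \<open>x\<close> satisfies, in column \<open>j\<close>, that \<open>\<Sum>\<^sub>i (x\<^sub>i\<^sup>j - P\<^sup>j)\<close> and
  \<open>2\<beta>(P\<^sup>j - 1/2)\<close> have the same integral against the likelihood of \<open>x\<close>; this is just the
  recursion \<open>(a + b) B(a + 1, b) = a B(a, b)\<close>. Hence the rows' correlations
  \<open>Z\<^sub>i = \<Sum>\<^sub>j M(X)\<^sup>j (X\<^sub>i\<^sup>j - P\<^sup>j)\<close> add up to at least \<open>2\<beta>\<gamma>k\<close> in expectation.
  Conversely, replacing row \<open>i\<close> by a fresh one makes \<open>Z\<^sub>i\<close> centred with second moment at most
  \<open>k/4\<close>, and privacy, applied to the positive and negative parts of \<open>Z\<^sub>i\<close>, bounds
  \<open>E Z\<^sub>i\<close> by \<open>sinh 1 \<cdot> \<surd>k/2 + \<delta>d(1 + 1/e)\<close>. Comparing the two yields the theorem because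
  \<open>sinh 1 / 2 \<le> 1 - 1/e\<close>, i.e. \<open>(e - 1)(3 - e) \<ge> 0\<close>.
\<close>

section \<open>From event probabilities to expectations under approximate privacy\<close>

text \<open>Tonelli for the region under the graph of \<open>h\<close>. Since \<open>h\<close> never
  exceeds \<open>D\<close>, levels above \<open>D\<close> contribute nothing; the cut to
  \<open>{0..D}\<close> is kept explicit so that an additive error at each level integrates to a
  finite amount.\<close>

lemma nn_integral_layer_cake:
  fixes h :: "'a \<Rightarrow> real"
  assumes "sigma_finite_measure \<mu>" and [measurable]: "h \<in> borel_measurable \<mu>"
    and h: "\<And>y. y \<in> space \<mu> \<Longrightarrow> 0 \<le> h y \<and> h y \<le> D"
  shows "(\<integral>\<^sup>+y. ennreal (h y) \<partial>\<mu>) =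
    (\<integral>\<^sup>+t. emeasure \<mu> {y \<in> space \<mu>. t < h y} * indicator {0..D} t \<partial>lborel)"
proof -
  interpret sigma_finite_measure \<mu> by fact
  interpret pair_sigma_finite \<mu> lborel ..
  have "(\<integral>\<^sup>+y. ennreal (h y) \<partial>\<mu>) =
      (\<integral>\<^sup>+y. (\<integral>\<^sup>+t. indicator {z \<in> space (\<mu> \<Otimes>\<^sub>M lborel). 0 \<le> snd z \<and> snd z < h (fst z)} (y, t) \<partial>lborel) \<partial>\<mu>)"
  proof (rule nn_integral_cong)
    fix y assume y: "y \<in> space \<mu>"
    have "(\<integral>\<^sup>+t. indicator {z \<in> space (\<mu> \<Otimes>\<^sub>M lborel). 0 \<le> snd z \<and> snd z < h (fst z)} (y, t) \<partial>lborel)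
        = (\<integral>\<^sup>+t. indicator {0..<h y} t \<partial>lborel)"
      by (rule nn_integral_cong) (use y in \<open>auto simp: indicator_def space_pair_measure\<close>)
    then show "ennreal (h y) = (\<integral>\<^sup>+t. indicator {z \<in> space (\<mu> \<Otimes>\<^sub>M lborel). 0 \<le> snd z \<and> snd z < h (fst z)} (y, t) \<partial>lborel)"
      using h[OF y] by simp
  qed
  also have "\<dots> = (\<integral>\<^sup>+t. (\<integral>\<^sup>+y. indicator {z \<in> space (\<mu> \<Otimes>\<^sub>M lborel). 0 \<le> snd z \<and> snd z < h (fst z)} (y, t) \<partial>\<mu>) \<partial>lborel)"
    by (subst Fubini') auto
  also have "\<dots> = (\<integral>\<^sup>+t. emeasure \<mu> {y \<in> space \<mu>. t < h y} * indicator {0..D} t \<partial>lborel)"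
  proof (rule nn_integral_cong)
    fix t :: real
    have "(\<integral>\<^sup>+y. indicator {z \<in> space (\<mu> \<Otimes>\<^sub>M lborel). 0 \<le> snd z \<and> snd z < h (fst z)} (y, t) \<partial>\<mu>)
        = (\<integral>\<^sup>+y. indicator {y \<in> space \<mu>. t < h y} y * indicator {0..D} t \<partial>\<mu>)"
      by (rule nn_integral_cong) (use h in \<open>auto simp: indicator_def space_pair_measure, fastforce\<close>)
    also have "\<dots> = emeasure \<mu> {y \<in> space \<mu>. t < h y} * indicator {0..D} t"
      by (subst nn_integral_multc) auto
    finally show "(\<integral>\<^sup>+y. indicator {z \<in> space (\<mu> \<Otimes>\<^sub>M lborel). 0 \<le> snd z \<and> snd z < h (fst z)} (y, t) \<partial>\<mu>)
        = emeasure \<mu> {y \<in> space \<mu>. t < h y} * indicator {0..D} t" .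
  qed
  finally show ?thesis .
qed

text \<open>The event inequality is applied to every superlevel set of \<open>h\<close> and
  integrated over the levels, an interval of length \<open>D\<close>; hence the error
  \<open>\<delta> * D\<close>.\<close>

lemma integral_le_of_measure_le:
  fixes h :: "'a \<Rightarrow> real"
  assumes \<mu>: "prob_space \<mu>" and \<nu>: "prob_space \<nu>" and sets: "sets \<nu> = sets \<mu>"
    and meas [measurable]: "h \<in> borel_measurable \<mu>"
    and h: "\<And>y. y \<in> space \<mu> \<Longrightarrow> 0 \<le> h y \<and> h y \<le> D"
    and le: "\<And>R. R \<in> sets \<mu> \<Longrightarrow> measure \<mu> R \<le> c * measure \<nu> R + \<delta>"
    and "0 \<le> c" "0 \<le> \<delta>" "0 \<le> D"
  shows "(\<integral>y. h y \<partial>\<mu>) \<le> c * (\<integral>y. h y \<partial>\<nu>) + \<delta> * D"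
proof -
  interpret \<mu>: prob_space \<mu> by fact
  interpret \<nu>: prob_space \<nu> by fact
  interpret pair_sigma_finite \<nu> lborel ..
  have space: "space \<nu> = space \<mu>" using sets by (rule sets_eq_imp_space_eq)
  have meas' [measurable]: "h \<in> borel_measurable \<nu>" using meas sets
    by (simp cong: measurable_cong_sets)
  have int: "integrable \<mu> h" "integrable \<nu> h"
    using h by (auto intro!: \<mu>.integrable_const_bound[of _ D] \<nu>.integrable_const_bound[of _ D] simp: space)
  have nn: "(\<integral>\<^sup>+y. ennreal (h y) \<partial>\<mu>) = ennreal (\<integral>y. h y \<partial>\<mu>)"
    "(\<integral>\<^sup>+y. ennreal (h y) \<partial>\<nu>) = ennreal (\<integral>y. h y \<partial>\<nu>)"
    using h by (auto intro!: nn_integral_eq_integral int simp: space)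
  have nonneg: "0 \<le> (\<integral>y. h y \<partial>\<nu>)"
    by (rule Bochner_Integration.integral_nonneg) (use h in \<open>simp add: space\<close>)
  have tail [measurable]: "(\<lambda>t. emeasure \<nu> {y \<in> space \<nu>. t < h y}) \<in> borel_measurable borel"
    by measurable
  have "ennreal (\<integral>y. h y \<partial>\<mu>) =
      (\<integral>\<^sup>+t. emeasure \<mu> {y \<in> space \<mu>. t < h y} * indicator {0..D} t \<partial>lborel)"
    unfolding nn[symmetric] using h by (intro nn_integral_layer_cake) (auto intro: \<mu>.sigma_finite_measure_axioms)
  also have "\<dots> \<le> (\<integral>\<^sup>+t. ennreal c * (emeasure \<nu> {y \<in> space \<nu>. t < h y} * indicator {0..D} t)
      + ennreal \<delta> * indicator {0..D} t \<partial>lborel)"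
  proof (rule nn_integral_mono)
    fix t :: real
    have "emeasure \<mu> {y \<in> space \<mu>. t < h y} \<le> ennreal c * emeasure \<nu> {y \<in> space \<mu>. t < h y} + ennreal \<delta>"
      using le[of "{y \<in> space \<mu>. t < h y}"] \<open>0 \<le> c\<close> \<open>0 \<le> \<delta>\<close>
      by (simp add: \<mu>.emeasure_eq_measure \<nu>.emeasure_eq_measure ennreal_mult'[symmetric] ennreal_plus[symmetric] del: ennreal_plus)
    then show "emeasure \<mu> {y \<in> space \<mu>. t < h y} * indicator {0..D} t
        \<le> ennreal c * (emeasure \<nu> {y \<in> space \<nu>. t < h y} * indicator {0..D} t) + ennreal \<delta> * indicator {0..D} t"
      by (simp add: space indicator_def)
  qed
  also have "\<dots> = ennreal c * (\<integral>\<^sup>+t. emeasure \<nu> {y \<in> space \<nu>. t < h y} * indicator {0..D} t \<partial>lborel) + ennreal \<delta> * ennreal D"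
    using \<open>0 \<le> D\<close> by (subst nn_integral_add) (auto simp: nn_integral_cmult nn_integral_cmult_indicator)
  also have "(\<integral>\<^sup>+t. emeasure \<nu> {y \<in> space \<nu>. t < h y} * indicator {0..D} t \<partial>lborel) = ennreal (\<integral>y. h y \<partial>\<nu>)"
    unfolding nn[symmetric] using h by (intro nn_integral_layer_cake[symmetric]) (auto intro: \<nu>.sigma_finite_measure_axioms simp: space)
  also have "ennreal c * ennreal (\<integral>y. h y \<partial>\<nu>) + ennreal \<delta> * ennreal D = ennreal (c * (\<integral>y. h y \<partial>\<nu>) + \<delta> * D)"
    using \<open>0 \<le> c\<close> \<open>0 \<le> \<delta>\<close> \<open>0 \<le> D\<close> nonneg by (simp add: ennreal_mult')
  finally show ?thesis
    using \<open>0 \<le> c\<close> \<open>0 \<le> \<delta>\<close> \<open>0 \<le> D\<close> nonneg by (subst (asm) ennreal_le_iff) auto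
qed


text \<open>The positive part of \<open>h\<close> moves from \<open>\<mu>\<close> to
  \<open>\<nu>\<close>; the negative part enters with a minus sign and uses the reverse inequality
  divided by \<open>exp \<epsilon>\<close>, so the two errors add up to the factor
  \<open>1 + exp (- \<epsilon>)\<close>. Writing the outcome with \<open>cosh\<close> and
  \<open>sinh\<close> separates a linear term, which vanishes once \<open>h\<close> is centred, from
  a multiple of \<open>\<bar>h y\<bar>\<close>.\<close>

lemma integral_le_of_dp:
  fixes h :: "'a \<Rightarrow> real"
  assumes \<mu>: "prob_space \<mu>" and \<nu>: "prob_space \<nu>" and sets: "sets \<nu> = sets \<mu>"
    and meas [measurable]: "h \<in> borel_measurable \<mu>"
    and h: "\<And>y. y \<in> space \<mu> \<Longrightarrow> \<bar>h y\<bar> \<le> D"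
    and le: "\<And>R. R \<in> sets \<mu> \<Longrightarrow> measure \<mu> R \<le> exp \<epsilon> * measure \<nu> R + \<delta>"
    and le': "\<And>R. R \<in> sets \<mu> \<Longrightarrow> measure \<nu> R \<le> exp \<epsilon> * measure \<mu> R + \<delta>"
    and "0 \<le> \<delta>" "0 \<le> D"
  shows "(\<integral>y. h y \<partial>\<mu>) \<le> (\<integral>y. cosh \<epsilon> * h y + sinh \<epsilon> * \<bar>h y\<bar> \<partial>\<nu>) + \<delta> * D * (1 + exp (- \<epsilon>))"
proof -
  interpret \<mu>: prob_space \<mu> by fact
  interpret \<nu>: prob_space \<nu> by fact
  have space: "space \<nu> = space \<mu>" using sets by (rule sets_eq_imp_space_eq)
  have meas' [measurable]: "h \<in> borel_measurable \<nu>" using meas sets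
    by (simp cong: measurable_cong_sets)
  define p n where "p y = max 0 (h y)" and "n y = max 0 (- h y)" for y
  have pn: "h y = p y - n y" "\<bar>h y\<bar> = p y + n y" for y by (auto simp: p_def n_def)
  have [measurable]: "p \<in> borel_measurable \<mu>" "n \<in> borel_measurable \<mu>"
    "p \<in> borel_measurable \<nu>" "n \<in> borel_measurable \<nu>"
    unfolding p_def n_def by measurable
  have bd: "0 \<le> p y \<and> p y \<le> D" "0 \<le> n y \<and> n y \<le> D" if "y \<in> space \<mu>" for y
    using h[OF that] \<open>0 \<le> D\<close> by (auto simp: p_def n_def)
  have int [simp]: "integrable \<mu> p" "integrable \<mu> n" "integrable \<nu> p" "integrable \<nu> n"
    using bd by (auto intro!: \<mu>.integrable_const_bound[of _ D] \<nu>.integrable_const_bound[of _ D] simp: space)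
  have 1: "(\<integral>y. p y \<partial>\<mu>) \<le> exp \<epsilon> * (\<integral>y. p y \<partial>\<nu>) + \<delta> * D"
    by (rule integral_le_of_measure_le) (use assms bd in auto)
  have "(\<integral>y. n y \<partial>\<nu>) \<le> exp \<epsilon> * (\<integral>y. n y \<partial>\<mu>) + \<delta> * D"
    by (rule integral_le_of_measure_le) (use assms bd space in auto)
  then have "exp (-\<epsilon>) * (\<integral>y. n y \<partial>\<nu>) \<le> exp (-\<epsilon>) * (exp \<epsilon> * (\<integral>y. n y \<partial>\<mu>) + \<delta> * D)"
    by (rule mult_left_mono) simp
  also have "\<dots> = (\<integral>y. n y \<partial>\<mu>) + exp (-\<epsilon>) * (\<delta> * D)"
    by (simp add: algebra_simps exp_minus)
  finally have 2: "exp (-\<epsilon>) * (\<integral>y. n y \<partial>\<nu>) \<le> (\<integral>y. n y \<partial>\<mu>) + exp (-\<epsilon>) * (\<delta> * D)" .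
  have "cosh \<epsilon> * h y + sinh \<epsilon> * \<bar>h y\<bar> = exp \<epsilon> * p y - exp (-\<epsilon>) * n y" for y
    unfolding pn(2) cosh_def sinh_def unfolding pn(1) by (simp add: field_simps)
  then have "(\<integral>y. cosh \<epsilon> * h y + sinh \<epsilon> * \<bar>h y\<bar> \<partial>\<nu>) = exp \<epsilon> * (\<integral>y. p y \<partial>\<nu>) - exp (-\<epsilon>) * (\<integral>y. n y \<partial>\<nu>)"
    by simp
  moreover have "(\<integral>y. h y \<partial>\<mu>) = (\<integral>y. p y \<partial>\<mu>) - (\<integral>y. n y \<partial>\<mu>)"
    unfolding pn(1) by simp
  ultimately show ?thesis using 1 2 by (simp add: algebra_simps)
qed

section \<open>Moments of the Beta distribution and conjugacy\<close>

lemma nn_integral_beta_density: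
  assumes "a > 0" "b > (0::real)"
  shows "(\<integral>\<^sup>+p. ennreal (indicator {0<..<1} p * p powr (a - 1) * (1 - p) powr (b - 1)) \<partial>lborel)
    = ennreal (Beta a b)"
proof -
  have "(\<integral>\<^sup>+p. ennreal (indicator {0<..<1} p * p powr (a - 1) * (1 - p) powr (b - 1)) \<partial>lborel)
     = (\<integral>\<^sup>+p. ennreal (p powr (a - 1) * (1 - p) powr (b - 1)) * indicator {0..1} p \<partial>lborel)"
    \<comment> \<open>The integrands agree even at the endpoints, because
      \<open>0 powr x = 0\<close> for every \<open>x\<close>.\<close>
    by (rule nn_integral_cong) (auto simp: indicator_def)
  also have "\<dots> = ennreal (Beta a b)"
    by (rule nn_integral_has_integral_lebesgue') (use assms has_integral_Beta_real in auto)
  finally show ?thesis .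
qed

lemma Beta_pos:
  assumes "a > 0" "b > (0::real)"
  shows "Beta a b > 0"
  using assms by (simp add: Beta_def Gamma_real_pos)

text \<open>Multiplying by the monomial only shifts exponents, so the integrand becomes an
  unnormalised Beta density with parameters \<open>a + real m\<close> and
  \<open>b + real l\<close>.\<close>

lemma beta_moment:
  assumes "a > 0" "b > (0::real)"
  shows "has_bochner_integral (beta_measure a b) (\<lambda>p. p ^ m * (1 - p) ^ l)
    (Beta (a + real m) (b + real l) / Beta a b)"
  unfolding beta_measure_def
proof (rule has_bochner_integral_density)
  let ?f = "\<lambda>p::real. indicator {0<..<1} p * p powr (a + real m - 1) * (1 - p) powr (b + real l - 1)"
  have "has_bochner_integral lborel ?f (Beta (a + real m) (b + real l))"
    by (rule has_bochner_integral_nn_integral)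
       (use assms nn_integral_beta_density[of "a + real m" "b + real l"] Beta_pos[of "a + real m" "b + real l"] in auto)
  then have "has_bochner_integral lborel (\<lambda>p. ?f p / Beta a b) (Beta (a + real m) (b + real l) / Beta a b)"
    by (rule has_bochner_integral_divide_zero)
  also have "(\<lambda>p. ?f p / Beta a b) = (\<lambda>p. (indicator {0<..<1} p * p powr (a - 1) * (1 - p) powr (b - 1) / Beta a b) *\<^sub>R (p ^ m * (1 - p) ^ l))"
  proof
    fix p :: real
    have "p powr (a + real m - 1) = p powr (a - 1) * p ^ m"
      "(1 - p) powr (b + real l - 1) = (1 - p) powr (b - 1) * (1 - p) ^ l" if "0 < p" "p < 1"
      using that by (simp_all add: powr_realpow[symmetric] powr_add[symmetric] algebra_simps)
    then show "?f p / Beta a b = (indicator {0<..<1} p * p powr (a - 1) * (1 - p) powr (b - 1) / Beta a b) *\<^sub>R (p ^ m * (1 - p) ^ l)"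
      by (auto simp: indicator_def)
  qed
  finally show "has_bochner_integral lborel \<dots> (Beta (a + real m) (b + real l) / Beta a b)" .
qed (use Beta_pos[OF assms] in auto)

lemma prob_space_beta_measure:
  assumes "a > 0" "b > (0::real)"
  shows "prob_space (beta_measure a b)"
proof (rule prob_spaceI)
  have "emeasure (beta_measure a b) (space (beta_measure a b)) =
      (\<integral>\<^sup>+p. ennreal (indicator {0<..<1} p * p powr (a - 1) * (1 - p) powr (b - 1)) / ennreal (Beta a b) \<partial>lborel)"
    using Beta_pos[OF assms]
    by (simp add: beta_measure_def emeasure_density divide_ennreal)
  also have "\<dots> = ennreal (Beta a b) / ennreal (Beta a b)"
    by (subst nn_integral_divide) (simp_all add: nn_integral_beta_density[OF assms])
  also have "\<dots> = 1" using Beta_pos[OF assms] by (simp add: divide_ennreal)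
  finally show "emeasure (beta_measure a b) (space (beta_measure a b)) = 1" .
qed

lemma AE_beta_measure: "AE p in beta_measure a b. 0 < p \<and> p < 1"
  unfolding beta_measure_def by (subst AE_density) (auto simp: indicator_def)

lemma sets_beta_measure [measurable_cong]: "sets (beta_measure a b) = sets borel"
  by (simp add: beta_measure_def)

text \<open>After \<open>m\<close> ones and \<open>l\<close> zeros the posterior mean of
  \<open>p\<close> is \<open>(m + a) / (m + l + a + b)\<close>. The last factor is the deviation of
  \<open>p\<close> from this mean, negated and cleared of its denominator, so its integral against
  the likelihood vanishes.\<close>

lemma beta_posterior_identity:
  assumes "a > 0" "b > (0::real)"
  shows "has_bochner_integral (beta_measure a b)
    (\<lambda>p. p ^ m * (1 - p) ^ l * ((real m + a) - (real m + real l + a + b) * p)) 0"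
proof -
  let ?B = "\<lambda>m l. Beta (a + real m) (b + real l) / Beta a b"
  have "has_bochner_integral (beta_measure a b)
     (\<lambda>p. (real m + a) * (p ^ m * (1 - p) ^ l) - (real m + real l + a + b) * (p ^ Suc m * (1 - p) ^ l))
     ((real m + a) * ?B m l - (real m + real l + a + b) * ?B (Suc m) l)"
    by (intro has_bochner_integral_diff has_bochner_integral_mult_right beta_moment assms)
  moreover have "a + real m \<notin> \<int>\<^sub>\<le>\<^sub>0" using assms by (auto elim!: nonpos_Ints_cases)
  note Beta_plus1_left[OF this, of "b + real l"]
  then have "(real m + a) * ?B m l - (real m + real l + a + b) * ?B (Suc m) l = 0"
    by (simp add: algebra_simps diff_divide_distrib[symmetric] add_divide_distrib[symmetric])
  moreover have "(\<lambda>p. (real m + a) * (p ^ m * (1 - p) ^ l) - (real m + real l + a + b) * (p ^ Suc m * (1 - p) ^ l))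
      = (\<lambda>p. p ^ m * (1 - p) ^ l * ((real m + a) - (real m + real l + a + b) * p))"
    by (simp add: fun_eq_iff algebra_simps)
  ultimately show ?thesis by metis
qed

section \<open>Product Bernoulli rows: moments and resampling\<close>

definition row_prob :: "('d::finite \<Rightarrow> real) \<Rightarrow> ('d \<Rightarrow> bool) \<Rightarrow> real" where
  "row_prob P v = (\<Prod>j\<in>UNIV. if v j then P j else 1 - P j)"

lemma data_prob_rows: "data_prob P x = (\<Prod>i\<in>UNIV. row_prob P (x i))"
  by (simp add: data_prob_def row_prob_def)

text \<open>Grouping by columns exhibits the likelihood as a product of one-variable polynomials,
  the form in which an integral against the product prior factorises.\<close>

lemma data_prob_columns:
  "data_prob P x = (\<Prod>j\<in>UNIV. P j ^ card {i. x i j} * (1 - P j) ^ card {i. \<not> x i j})"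
  unfolding data_prob_def
  by (subst prod.swap) (simp add: prod.If_cases Collect_neg_eq[symmetric])

text \<open>Distributivity: the coordinates of a row are independent, so the expectation of a
  product over coordinates factorises. Total mass, means and covariances follow by choosing
  \<open>g\<close>.\<close>

lemma sum_row_prob_prod:
  "(\<Sum>v\<in>UNIV. row_prob P v * (\<Prod>j\<in>UNIV. g j (v j)))
    = (\<Prod>j\<in>UNIV. P j * g j True + (1 - P j) * g j False)"
proof -
  have "(\<Prod>j\<in>UNIV. P j * g j True + (1 - P j) * g j False)
      = (\<Prod>j\<in>UNIV. \<Sum>c\<in>UNIV. (if c then P j else 1 - P j) * g j c)"
    by (simp add: UNIV_bool add.commute)
  also have "\<dots> = (\<Sum>v\<in>UNIV. \<Prod>j\<in>UNIV. (if v j then P j else 1 - P j) * g j (v j))"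
    by (subst prod_sum_PiE) (auto simp: PiE_UNIV_domain)
  finally show ?thesis by (simp add: row_prob_def prod.distrib)
qed

lemma sum_row_prob: "(\<Sum>v\<in>UNIV. row_prob P v) = 1"
  using sum_row_prob_prod[of P "\<lambda>_ _. 1"] by simp

lemma row_prob_mean: "(\<Sum>v\<in>UNIV. row_prob P v * (of_bool (v j) - P j)) = 0"
proof -
  define g where "g l c = (if l = j then of_bool c - P j else 1)" for l c
  have "(\<Prod>l\<in>UNIV. g l (v l)) = of_bool (v j) - P j" for v
    by (simp add: g_def prod.If_cases)
  moreover have "(\<Prod>l\<in>UNIV. P l * g l True + (1 - P l) * g l False) = 0"
    by (rule prod_zero) (auto intro!: bexI[of _ j] simp: g_def algebra_simps)
  ultimately show ?thesis using sum_row_prob_prod[of P g] by simp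
qed

lemma row_prob_cov:
  "(\<Sum>v\<in>UNIV. row_prob P v * ((of_bool (v j) - P j) * (of_bool (v l) - P l)))
     = (if j = l then P j * (1 - P j) else 0)"
proof -
  \<comment> \<open>The product of two deviations is spread over the coordinates. For
    \<open>j = l\<close> both land on the same coordinate and give the variance; otherwise the
    factor at \<open>j\<close> averages to zero.\<close>
  define g where "g i c = (if i = j then of_bool c - P j else 1) * (if i = l then of_bool c - P l else 1)" for i c
  have 1: "(\<Prod>i\<in>UNIV. g i (v i)) = (of_bool (v j) - P j) * (of_bool (v l) - P l)" for v
    by (simp add: g_def prod.distrib prod.If_cases)
  have 2: "(\<Prod>i\<in>UNIV. P i * g i True + (1 - P i) * g i False) = (if j = l then P j * (1 - P j) else 0)"
  proof (cases "j = l")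
    case True
    have "(\<Prod>i\<in>UNIV. P i * g i True + (1 - P i) * g i False) = (\<Prod>i\<in>UNIV. if i = j then P j * (1 - P j) else 1)"
      by (rule prod.cong) (auto simp: g_def True algebra_simps)
    then show ?thesis using True by (simp add: prod.If_cases)
  next
    case False
    have "(\<Prod>i\<in>UNIV. P i * g i True + (1 - P i) * g i False) = 0"
      by (rule prod_zero) (use False in \<open>auto intro!: bexI[of _ j] simp: g_def algebra_simps\<close>)
    then show ?thesis using False by simp
  qed
  show ?thesis using sum_row_prob_prod[of P g] unfolding 1 2 .
qed

lemma sum_prod_rows:
  fixes r :: "'r::finite \<Rightarrow> real"
  assumes "(\<Sum>u\<in>UNIV. r u) = 1"
  shows "(\<Sum>x\<in>UNIV. \<Prod>i\<in>UNIV. r (x (i::'n::finite))) = 1"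
  using prod_sum_PiE[of "UNIV :: 'n set" "\<lambda>_. UNIV" "\<lambda>_. r"] assms by (simp add: PiE_UNIV_domain)

text \<open>Swapping row \<open>i\<close> with the fresh row \<open>u\<close> is an involution on
  the pairs \<open>(x, u)\<close>. It preserves the weight because all rows, the fresh one included,
  have the same law \<open>r\<close>.\<close>

lemma sum_resample:
  fixes r :: "'r::finite \<Rightarrow> real" and i :: "'n::finite"
  shows "(\<Sum>x\<in>UNIV. \<Sum>u\<in>UNIV. (\<Prod>i\<in>UNIV. r (x i)) * r u * F (x i) (x(i := u)))
    = (\<Sum>x\<in>UNIV. \<Sum>u\<in>UNIV. (\<Prod>i\<in>UNIV. r (x i)) * r u * F u x)"
proof -
  have swap: "(\<Prod>k\<in>UNIV. r (x k)) * r u = (\<Prod>k\<in>UNIV. r ((x(i := u)) k)) * r (x i)" for x u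
  proof -
    have "(\<Prod>k\<in>UNIV. r (x k)) = r (x i) * (\<Prod>k\<in>UNIV - {i}. r (x k))"
      "(\<Prod>k\<in>UNIV. r ((x(i := u)) k)) = r u * (\<Prod>k\<in>UNIV - {i}. r (x k))"
      by (subst prod.remove[of _ i]; simp)+
    then show ?thesis by simp
  qed
  have "(\<lambda>(x, u). (\<Prod>k\<in>UNIV. r ((x(i := u)) k)) * r (x i) * F (x i) (x(i := u)))
      = (\<lambda>(x, u). (\<Prod>k\<in>UNIV. r (x k)) * r u * F (x i) (x(i := u)))"
    by (simp only: swap[symmetric])
  then show ?thesis
    unfolding sum.cartesian_product
    by (intro sum.reindex_bij_witness[of _ "\<lambda>(x, u). (x(i := u), x i)" "\<lambda>(x, u). (x(i := u), x i)"])
       (auto simp: fun_eq_iff simp del: fun_upd_apply, simp_all)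
qed

lemma data_prob_nonneg: "(\<And>j. 0 \<le> P j \<and> P j \<le> 1) \<Longrightarrow> 0 \<le> data_prob P x"
  unfolding data_prob_def by (intro prod_nonneg) auto

lemma data_prob_le_1: "(\<And>j. 0 \<le> P j \<and> P j \<le> 1) \<Longrightarrow> data_prob P x \<le> 1"
  unfolding data_prob_def by (intro prod_le_1 conjI prod_nonneg) auto

lemma row_prob_nonneg: "(\<And>j. 0 \<le> P j \<and> P j \<le> 1) \<Longrightarrow> 0 \<le> row_prob P v"
  unfolding row_prob_def by (intro prod_nonneg) auto

lemma sum_data_prob: "(\<Sum>x\<in>UNIV. data_prob P x) = 1"
  unfolding data_prob_rows by (rule sum_prod_rows) (rule sum_row_prob)

section \<open>The product prior and the fingerprinting identity for one column\<close>

lemma prob_space_beta_prior: "\<beta> > 0 \<Longrightarrow> prob_space (beta_prior \<beta>)"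
  unfolding beta_prior_def by (intro prob_space_PiM prob_space_beta_measure)

text \<open>Bounds on the likelihood need \<open>P\<close> in the unit cube, but the prior is a
  measure on all real vectors; this makes them available almost everywhere.\<close>

lemma AE_beta_prior:
  assumes "\<beta> > 0"
  shows "AE P in (beta_prior \<beta> :: ('d::finite \<Rightarrow> real) measure). \<forall>j. 0 < P j \<and> P j < 1"
proof -
  have "AE P in (beta_prior \<beta> :: ('d::finite \<Rightarrow> real) measure). 0 < P j \<and> P j < 1" for j
    unfolding beta_prior_def
    by (rule AE_PiM_component[where P = "\<lambda>p. 0 < p \<and> p < 1"])
       (rule prob_space_beta_measure[OF assms assms] UNIV_I AE_beta_measure)+
  then show ?thesis by (simp add: AE_all_countable)
qed

lemma measurable_beta_prior_component [measurable]: "(\<lambda>P. P j) \<in> borel_measurable (beta_prior \<beta>)"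
proof -
  have "(\<lambda>P. P j) \<in> measurable (beta_prior \<beta>) (beta_measure \<beta> \<beta>)"
    unfolding beta_prior_def by (rule measurable_component_singleton) simp
  then show ?thesis by (simp cong: measurable_cong_sets add: sets_beta_measure)
qed

lemma measurable_data_prob [measurable]: "(\<lambda>P. data_prob P x) \<in> borel_measurable (beta_prior \<beta>)"
  unfolding data_prob_columns by measurable

lemma integrable_data_prob:
  assumes "\<beta> > 0"
  shows "integrable (beta_prior \<beta>) (\<lambda>P. data_prob P x)"
proof -
  interpret prob_space "beta_prior \<beta>" using assms by (rule prob_space_beta_prior)
  show ?thesis
  proof (rule integrable_const_bound[of _ 1])
    show "AE P in beta_prior \<beta>. norm (data_prob P x) \<le> 1"
      using AE_beta_prior[OF assms]
      by eventually_elim (auto simp: abs_of_nonneg data_prob_nonneg data_prob_le_1 less_imp_le)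
  qed measurable
qed

lemma integrable_data_prob_component:
  assumes "\<beta> > 0"
  shows "integrable (beta_prior \<beta>) (\<lambda>P. data_prob P x * P j)"
proof (rule Bochner_Integration.integrable_bound[OF integrable_data_prob[OF assms, of x]])
  show "AE P in beta_prior \<beta>. norm (data_prob P x * P j) \<le> norm (data_prob P x)"
    using AE_beta_prior[OF assms]
    by eventually_elim (auto simp: abs_mult less_imp_le intro!: mult_left_le)
qed measurable

lemma integrable_data_prob_affine:
  assumes "\<beta> > 0"
  shows "integrable (beta_prior \<beta>) (\<lambda>P. data_prob P x * (a + c * P j))"
proof -
  have "integrable (beta_prior \<beta>) (\<lambda>P. a * data_prob P x + c * (data_prob P x * P j))"
    using integrable_data_prob[OF assms, of x] integrable_data_prob_component[OF assms, of x j]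
    by (intro Bochner_Integration.integrable_add integrable_mult_right)
  then show ?thesis by (simp add: algebra_simps)
qed

text \<open>With \<open>a\<close> ones and \<open>b\<close> zeros in column \<open>j\<close>, the
  factor next to the likelihood equals \<open>(a + \<beta>) - (a + b + 2 * \<beta>) * P j\<close>,
  as in \<open>beta_posterior_identity\<close>. The integrand is thus a product over columns whose
  factor at \<open>j\<close> integrates to zero.\<close>

lemma beta_fingerprinting:
  fixes x :: "'n::finite \<Rightarrow> 'd::finite \<Rightarrow> bool"
  assumes "\<beta> > 0"
  shows "(\<integral>P. data_prob P x * ((\<Sum>i\<in>UNIV. of_bool (x i j) - P j) - 2 * \<beta> * (P j - 1/2)) \<partial>beta_prior \<beta>) = 0"
proof -
  interpret prob_space "beta_measure \<beta> \<beta>" using assms by (intro prob_space_beta_measure)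
  interpret product_sigma_finite "\<lambda>_::'d. beta_measure \<beta> \<beta>" ..
  define a b where "a l = card {i. x i l}" and "b l = card {i. \<not> x i l}" for l
  define f where "f l p = (if l = j then p ^ a l * (1 - p) ^ b l * ((real (a l) + \<beta>) - (real (a l) + real (b l) + \<beta> + \<beta>) * p)
    else p ^ a l * (1 - p) ^ b l)" for l p
  have ab: "real CARD('n) = real (a l) + real (b l)" for l
    unfolding a_def b_def using card_Un_disjoint[of "{i. x i l}" "{i. \<not> x i l}"]
    by (simp add: Un_def disjoint_iff)
  have int_f: "integrable (beta_measure \<beta> \<beta>) (f l)" for l
    unfolding f_def using beta_moment[OF assms assms, of "a l" "b l"]
      beta_posterior_identity[OF assms assms, of "a l" "b l"]
    by (cases "l = j") (auto simp: has_bochner_integral_iff)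
  have "integral\<^sup>L (beta_measure \<beta> \<beta>) (f j) = 0"
    unfolding f_def using beta_posterior_identity[OF assms assms, of "a j" "b j"]
    by (auto simp: has_bochner_integral_iff)
  then have "(\<integral>P. (\<Prod>l\<in>UNIV. f l (P l)) \<partial>beta_prior \<beta>) = 0"
    unfolding beta_prior_def by (subst product_integral_prod) (auto intro: int_f prod_zero)
  moreover have "data_prob P x * ((\<Sum>i\<in>UNIV. of_bool (x i j) - P j) - 2 * \<beta> * (P j - 1/2)) = (\<Prod>l\<in>UNIV. f l (P l))" for P
  proof -
    have S: "(\<Sum>i\<in>UNIV. of_bool (x i j) - P j) = real (a j) - real CARD('n) * P j"
      by (simp add: sum_subtractf a_def sum.If_cases of_bool_def)
    have "(\<Prod>l\<in>UNIV. f l (P l)) = (\<Prod>l\<in>UNIV. P l ^ a l * (1 - P l) ^ b l *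
        (if l = j then (real (a l) + \<beta>) - (real (a l) + real (b l) + \<beta> + \<beta>) * P l else 1))"
      by (rule prod.cong) (auto simp: f_def)
    then have T: "(\<Prod>l\<in>UNIV. f l (P l)) = data_prob P x * ((real (a j) + \<beta>) - (real (a j) + real (b j) + \<beta> + \<beta>) * P j)"
      by (simp add: prod.distrib data_prob_columns a_def b_def prod.If_cases)
    show ?thesis unfolding S T ab[of j] by (simp add: algebra_simps)
  qed
  ultimately show ?thesis by simp
qed

section \<open>Correlation of the output with a single row, for fixed \<open>P\<close>\<close>

lemma randomized_algD:
  assumes "randomized_alg M"
  shows "prob_space (M x)" "sets (M x) = sets (M x')"
    "(\<lambda>y. y j) \<in> borel_measurable (M x)"
    "y \<in> space (M x) \<Longrightarrow> \<bar>y j\<bar> \<le> 1"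
proof -
  have s: "prob_space (M x)" "sets (M x) = sets out_space" "space (M x) = space out_space" for x
    using assms by (auto simp: randomized_alg_def)
  show "prob_space (M x)" "sets (M x) = sets (M x')" using s by auto
  have "(\<lambda>y. y j) \<in> measurable out_space (restrict_space lborel {-1..1})"
    unfolding out_space_def by (rule measurable_component_singleton) simp
  then have "(\<lambda>y. y j) \<in> borel_measurable out_space"
    by (auto simp: measurable_restrict_space2_iff cong: measurable_cong_sets)
  then show "(\<lambda>y. y j) \<in> borel_measurable (M x)"
    using s by (simp cong: measurable_cong_sets)
  show "\<bar>y j\<bar> \<le> 1" if "y \<in> space (M x)"
    using that unfolding s out_space_def space_PiM by (auto simp: PiE_iff space_restrict_space abs_le_iff)
qed

text \<open>In place of Cauchy-Schwarz, \<open>\<bar>h\<bar>\<close> is bounded by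
  \<open>h^2 / (2 * s) + s / 2\<close> with \<open>s\<close> free. The bound is then affine in the
  second moment of the output and can later be averaged over \<open>P\<close> without a concavity
  argument.\<close>

lemma row_correlation_bound:
  fixes M :: "('n::finite \<Rightarrow> 'd::finite \<Rightarrow> bool) \<Rightarrow> ('d \<Rightarrow> real) measure"
  assumes M: "randomized_alg M" and dp: "differentially_private \<epsilon> \<delta> M"
    and P: "\<And>j. 0 \<le> P j \<and> P j \<le> 1" and "0 \<le> \<epsilon>" "0 \<le> \<delta>" "0 < s"
  shows "(\<Sum>x\<in>UNIV. data_prob P x * (\<integral>y. (\<Sum>j\<in>UNIV. y j * (of_bool (x i j) - P j)) \<partial>M x))
    \<le> sinh \<epsilon> * ((\<Sum>x\<in>UNIV. data_prob P x * (\<integral>y. (\<Sum>j\<in>UNIV. (y j)\<^sup>2) \<partial>M x)) / (8 * s) + s / 2)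
      + \<delta> * real CARD('d) * (1 + exp (- \<epsilon>))"
proof -
  define h where "h v y = (\<Sum>j\<in>UNIV. y j * (of_bool (v j) - P j))" for v :: "'d \<Rightarrow> bool" and y
  \<comment> \<open>The transferred test of \<open>integral_le_of_dp\<close>, with
    \<open>\<bar>h v y\<bar>\<close> replaced by its quadratic majorant, so that averaging over a
    fresh row needs only first and second moments.\<close>
  define G where "G v y = cosh \<epsilon> * h v y + sinh \<epsilon> * ((h v y)\<^sup>2 / (2 * s) + s / 2)" for v y
  define Q where "Q y = (\<Sum>j\<in>UNIV. (y j)\<^sup>2)" for y :: "'d \<Rightarrow> real"
  define C where "C = \<delta> * real CARD('d) * (1 + exp (- \<epsilon>))"
  have ps: "prob_space (M x)" for x using randomized_algD(1)[OF M] .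
  note [measurable] = randomized_algD(3)[OF M]
  have h_meas [measurable]: "h v \<in> borel_measurable (M x)" for v x unfolding h_def by measurable
  \<comment> \<open>This is the range \<open>D\<close> in \<open>integral_le_of_dp\<close> and the
    source of the factor \<open>real CARD('d)\<close> next to \<open>\<delta>\<close>.\<close>
  have h_bound: "\<bar>h v y\<bar> \<le> real CARD('d)" if "y \<in> space (M x)" for v y x
  proof -
    have "\<bar>y j * (of_bool (v j) - P j)\<bar> \<le> 1" for j
      using randomized_algD(4)[OF M that, of j] P[of j]
      by (auto simp: abs_mult intro!: mult_le_one)
    then have "(\<Sum>j\<in>UNIV. \<bar>y j * (of_bool (v j) - P j)\<bar>) \<le> (\<Sum>j\<in>(UNIV :: 'd set). 1)"
      by (intro sum_mono)
    then show ?thesis unfolding h_def by (intro order_trans[OF sum_abs]) simp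
  qed
  have int [simp]: "integrable (M x) (h v)" "integrable (M x) (\<lambda>y. (h v y)\<^sup>2)"
    "integrable (M x) Q" "integrable (M x) (G v)" "integrable (M x) (\<lambda>_. c :: real)" for x v c
  proof -
    interpret prob_space "M x" by (rule ps)
    show 1: "integrable (M x) (h v)"
      using h_bound by (intro integrable_const_bound[of _ "real CARD('d)"]) auto
    show 2: "integrable (M x) (\<lambda>y. (h v y)\<^sup>2)"
      using power_mono[OF h_bound abs_ge_zero, of _ x v 2]
      by (intro integrable_const_bound[of _ "(real CARD('d))\<^sup>2"]) auto
    show "integrable (M x) Q"
      unfolding Q_def using randomized_algD(4)[OF M]
      by (intro Bochner_Integration.integrable_sum integrable_const_bound[of _ 1]) (auto simp: abs_square_le_1)
    show "integrable (M x) (G v)"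
      unfolding G_def using 1 2 by auto
    show "integrable (M x) (\<lambda>_. c)" by simp
  qed
  have one: "(\<integral>y. h v y \<partial>M x) \<le> (\<integral>y. G v y \<partial>M (x(i := u))) + C" for v x u
  proof -
    have nb: "neighbors x (x(i := u))" "neighbors (x(i := u)) x"
      by (auto simp: neighbors_def)
    have "(\<integral>y. h v y \<partial>M x) \<le> (\<integral>y. cosh \<epsilon> * h v y + sinh \<epsilon> * \<bar>h v y\<bar> \<partial>M (x(i := u))) + C"
      unfolding C_def
    proof (rule integral_le_of_dp)
      show "sets (M (x(i := u))) = sets (M x)" by (rule randomized_algD(2)[OF M])
      then show "measure (M x) R \<le> exp \<epsilon> * measure (M (x(i := u))) R + \<delta>"
        "measure (M (x(i := u))) R \<le> exp \<epsilon> * measure (M x) R + \<delta>" if "R \<in> sets (M x)" for R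
        using dp nb that unfolding differentially_private_def by auto
    qed (use ps h_bound \<open>0 \<le> \<delta>\<close> in auto)
    also have "(\<integral>y. cosh \<epsilon> * h v y + sinh \<epsilon> * \<bar>h v y\<bar> \<partial>M (x(i := u))) \<le> (\<integral>y. G v y \<partial>M (x(i := u)))"
    proof (rule integral_mono)
      fix y
      have "0 \<le> (\<bar>h v y\<bar> - s)\<^sup>2" by simp
      then have "\<bar>h v y\<bar> \<le> (h v y)\<^sup>2 / (2 * s) + s / 2"
        using \<open>0 < s\<close> by (simp add: power2_diff field_simps power2_eq_square)
      then show "cosh \<epsilon> * h v y + sinh \<epsilon> * \<bar>h v y\<bar> \<le> G v y"
        unfolding G_def using \<open>0 \<le> \<epsilon>\<close> by (simp add: mult_left_mono)
    qed auto
    finally show ?thesis by simp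
  qed
  \<comment> \<open>With \<open>y\<close> held fixed while the row is averaged, the
    \<open>cosh\<close> term vanishes and the second moment is diagonal with variances at most 1/4;
    dividing by \<open>2 * s\<close> gives the denominator \<open>8 * s\<close>.\<close>
  have avg: "(\<Sum>u\<in>UNIV. row_prob P u * G u y) \<le> sinh \<epsilon> * (Q y / (8 * s) + s / 2)" for y
  proof -
    have mean: "(\<Sum>u\<in>UNIV. row_prob P u * h u y) = 0"
    proof -
      have "(\<Sum>u\<in>UNIV. row_prob P u * h u y) = (\<Sum>j\<in>UNIV. y j * (\<Sum>u\<in>UNIV. row_prob P u * (of_bool (u j) - P j)))"
        unfolding h_def sum_distrib_left by (subst sum.swap) (simp add: algebra_simps)
      then show ?thesis by (simp add: row_prob_mean)
    qed
    have "(\<Sum>u\<in>UNIV. row_prob P u * (h u y)\<^sup>2)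
        = (\<Sum>u\<in>UNIV. \<Sum>j\<in>UNIV. \<Sum>l\<in>UNIV. y j * y l * (row_prob P u * ((of_bool (u j) - P j) * (of_bool (u l) - P l))))"
      unfolding h_def power2_eq_square sum_product unfolding sum_distrib_left
      by (intro sum.cong refl) (simp add: mult_ac)
    also have "\<dots> = (\<Sum>j\<in>UNIV. \<Sum>u\<in>UNIV. \<Sum>l\<in>UNIV. y j * y l * (row_prob P u * ((of_bool (u j) - P j) * (of_bool (u l) - P l))))"
      by (rule sum.swap)
    also have "\<dots> = (\<Sum>j\<in>UNIV. \<Sum>l\<in>UNIV. y j * y l * (\<Sum>u\<in>UNIV. row_prob P u * ((of_bool (u j) - P j) * (of_bool (u l) - P l))))"
      unfolding sum_distrib_left by (intro sum.cong refl) (rule sum.swap)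
    also have "\<dots> = (\<Sum>j\<in>UNIV. (y j)\<^sup>2 * (P j * (1 - P j)))"
      unfolding row_prob_cov by (simp add: if_distrib[of "(*) _"] power2_eq_square cong: if_cong)
    also have "\<dots> \<le> (\<Sum>j\<in>UNIV. (y j)\<^sup>2 * (1/4))"
    proof (intro sum_mono mult_left_mono)
      fix j
      have "0 \<le> (P j - 1/2)\<^sup>2" by simp
      then show "P j * (1 - P j) \<le> 1/4" by (simp add: power2_eq_square algebra_simps)
    qed auto
    finally have var: "(\<Sum>u\<in>UNIV. row_prob P u * (h u y)\<^sup>2) \<le> Q y / 4"
      by (simp add: Q_def sum_divide_distrib)
    have "(\<Sum>u\<in>UNIV. row_prob P u * G u y) = cosh \<epsilon> * (\<Sum>u\<in>UNIV. row_prob P u * h u y)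
       + sinh \<epsilon> * ((\<Sum>u\<in>UNIV. row_prob P u * (h u y)\<^sup>2) / (2 * s) + (\<Sum>u\<in>UNIV. row_prob P u) * (s / 2))"
      unfolding G_def by (simp add: sum_distrib_left sum_distrib_right sum_divide_distrib sum.distrib[symmetric] algebra_simps)
    also have "(\<Sum>u\<in>UNIV. row_prob P u * (h u y)\<^sup>2) / (2 * s) + (\<Sum>u\<in>UNIV. row_prob P u) * (s / 2) \<le> Q y / (8 * s) + s / 2"
      unfolding sum_row_prob using \<open>0 < s\<close> var by (simp add: field_simps)
    finally have "(\<Sum>u\<in>UNIV. row_prob P u * G u y) \<le> cosh \<epsilon> * (\<Sum>u\<in>UNIV. row_prob P u * h u y) + sinh \<epsilon> * (Q y / (8 * s) + s / 2)"
      using \<open>0 \<le> \<epsilon>\<close> by (simp add: mult_left_mono)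
    then show ?thesis by (simp add: mean)
  qed
  have nn: "0 \<le> data_prob P x" "0 \<le> row_prob P v" for x :: "'n \<Rightarrow> 'd \<Rightarrow> bool" and v
    using P by (auto intro: data_prob_nonneg row_prob_nonneg)
  \<comment> \<open>Exchanging row \<open>i\<close> with its fresh copy preserves the joint law, so the row that is tested
    becomes independent of the dataset given to \<open>M\<close>.\<close>
  have "(\<Sum>x\<in>UNIV. data_prob P x * (\<integral>y. h (x i) y \<partial>M x))
      = (\<Sum>x\<in>UNIV. \<Sum>u\<in>UNIV. data_prob P x * row_prob P u * (\<integral>y. h (x i) y \<partial>M x))"
    by (simp add: sum_distrib_left[symmetric] sum_distrib_right[symmetric] sum_row_prob)
  also have "\<dots> \<le> (\<Sum>x\<in>UNIV. \<Sum>u\<in>UNIV. data_prob P x * row_prob P u * ((\<integral>y. G (x i) y \<partial>M (x(i := u))) + C))"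
    by (intro sum_mono mult_left_mono one mult_nonneg_nonneg nn)
  also have "\<dots> = (\<Sum>x\<in>UNIV. \<Sum>u\<in>UNIV. data_prob P x * row_prob P u * ((\<integral>y. G u y \<partial>M x) + C))"
    unfolding data_prob_rows by (rule sum_resample[of "row_prob P" "\<lambda>v x. (\<integral>y. G v y \<partial>M x) + C"])
  also have "\<dots> = (\<Sum>x\<in>UNIV. data_prob P x * ((\<Sum>u\<in>UNIV. row_prob P u * (\<integral>y. G u y \<partial>M x)) + (\<Sum>u\<in>UNIV. row_prob P u) * C))"
    by (simp add: sum_distrib_left sum_distrib_right sum.distrib[symmetric] algebra_simps)
  also have "\<dots> \<le> (\<Sum>x\<in>UNIV. data_prob P x * (sinh \<epsilon> * ((\<integral>y. Q y \<partial>M x) / (8 * s) + s / 2) + C))"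
  proof (intro sum_mono mult_left_mono nn)
    fix x :: "'n \<Rightarrow> 'd \<Rightarrow> bool"
    interpret prob_space "M x" by (rule ps)
    have "(\<Sum>u\<in>UNIV. row_prob P u * (\<integral>y. G u y \<partial>M x)) = (\<integral>y. (\<Sum>u\<in>UNIV. row_prob P u * G u y) \<partial>M x)"
      by simp
    also have "\<dots> \<le> (\<integral>y. sinh \<epsilon> * (Q y / (8 * s) + s / 2) \<partial>M x)"
      by (intro integral_mono avg) auto
    also have "\<dots> = sinh \<epsilon> * ((\<integral>y. Q y \<partial>M x) / (8 * s) + s / 2)"
      by (simp add: prob_space)
    finally show "(\<Sum>u\<in>UNIV. row_prob P u * (\<integral>y. G u y \<partial>M x)) + (\<Sum>u\<in>UNIV. row_prob P u) * C
        \<le> sinh \<epsilon> * ((\<integral>y. Q y \<partial>M x) / (8 * s) + s / 2) + C"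
      by (simp add: sum_row_prob)
  qed
  also have "\<dots> = sinh \<epsilon> * ((\<Sum>x\<in>UNIV. data_prob P x * (\<integral>y. Q y \<partial>M x)) / (8 * s)
        + (\<Sum>x\<in>(UNIV :: ('n \<Rightarrow> 'd \<Rightarrow> bool) set). data_prob P x) * (s / 2))
      + (\<Sum>x\<in>(UNIV :: ('n \<Rightarrow> 'd \<Rightarrow> bool) set). data_prob P x) * C"
    by (simp add: sum_distrib_left sum_distrib_right sum_divide_distrib sum.distrib algebra_simps)
  finally show ?thesis
    by (simp add: sum_data_prob h_def Q_def C_def)
qed


section \<open>Averaging over the prior\<close>

text \<open>The affine shape \<open>\<alpha> x j + c * P j\<close> covers both statistics in use:
  the row deviation \<open>of_bool (x i j) - P j\<close> and the centred parameter
  \<open>P j - 1/2\<close>.\<close>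

lemma joint_expectation_linear:
  fixes M :: "('n::finite \<Rightarrow> 'd::finite \<Rightarrow> bool) \<Rightarrow> ('d \<Rightarrow> real) measure"
  assumes M: "randomized_alg M" and "\<beta> > 0"
  shows "integrable (beta_prior \<beta>) (\<lambda>P. \<Sum>x\<in>UNIV. data_prob P x * (\<integral>y. (\<Sum>j\<in>UNIV. y j * (\<alpha> x j + c * P j)) \<partial>M x))"
    (is ?int)
    and "joint_expectation \<beta> M (\<lambda>P x y. \<Sum>j\<in>UNIV. y j * (\<alpha> x j + c * P j))
      = (\<Sum>x\<in>UNIV. \<Sum>j\<in>UNIV. (\<integral>y. y j \<partial>M x) * (\<integral>P. data_prob P x * (\<alpha> x j + c * P j) \<partial>beta_prior \<beta>))"
    (is ?eq)
proof -
  have int_y [simp]: "integrable (M x) (\<lambda>y. y j)" for x j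
  proof -
    interpret prob_space "M x" by (rule randomized_algD(1)[OF M])
    show ?thesis using randomized_algD(3,4)[OF M] by (intro integrable_const_bound[of _ 1]) auto
  qed
  have eq: "(\<Sum>x\<in>UNIV. data_prob P x * (\<integral>y. (\<Sum>j\<in>UNIV. y j * (\<alpha> x j + c * P j)) \<partial>M x))
      = (\<Sum>x\<in>UNIV. \<Sum>j\<in>UNIV. (\<integral>y. y j \<partial>M x) * (data_prob P x * (\<alpha> x j + c * P j)))" for P
    by (simp add: sum_distrib_left mult_ac)
  note [simp] = integrable_data_prob_affine[OF \<open>\<beta> > 0\<close>]
  show ?int unfolding eq by (intro Bochner_Integration.integrable_sum integrable_mult_right) simp
  show ?eq unfolding joint_expectation_def eq by simp
qed

text \<open>The output depends on \<open>P\<close> only through \<open>x\<close>, so each mean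
  output \<open>\<integral>y. y j \<partial>M x\<close> is a constant multiplying a prior integral,
  and \<open>beta_fingerprinting\<close> applies for every \<open>x\<close> and \<open>j\<close>
  separately.\<close>

lemma joint_fingerprinting:
  fixes M :: "('n::finite \<Rightarrow> 'd::finite \<Rightarrow> bool) \<Rightarrow> ('d \<Rightarrow> real) measure"
  assumes M: "randomized_alg M" and "\<beta> > 0"
  shows "(\<Sum>i\<in>UNIV. joint_expectation \<beta> M (\<lambda>P x y. \<Sum>j\<in>UNIV. y j * (of_bool (x i j) - P j)))
    = 2 * \<beta> * joint_expectation \<beta> M (\<lambda>P x y. \<Sum>j\<in>UNIV. y j * (P j - 1/2))"
proof -
  define I where "I x q = (\<integral>P. data_prob P x * q P \<partial>beta_prior \<beta>)" for x :: "'n \<Rightarrow> 'd \<Rightarrow> bool" and q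
  note int = integrable_data_prob_affine[OF \<open>\<beta> > 0\<close>]
  \<comment> \<open>The spellings \<open>(-1) * P j\<close> and \<open>-1/2 + 1 * P j\<close> match
    the affine shape of the integrability and linearity lemmas.\<close>
  have fp: "(\<Sum>i\<in>UNIV. I x (\<lambda>P. of_bool (x i j) + (-1) * P j)) = 2 * \<beta> * I x (\<lambda>P. -1/2 + 1 * P j)" for x j
  proof -
    have "(\<Sum>i\<in>UNIV. I x (\<lambda>P. of_bool (x i j) + (-1) * P j)) - 2 * \<beta> * I x (\<lambda>P. -1/2 + 1 * P j)
        = (\<integral>P. (\<Sum>i\<in>UNIV. data_prob P x * (of_bool (x i j) + (-1) * P j))
            - 2 * \<beta> * (data_prob P x * (-1/2 + 1 * P j)) \<partial>beta_prior \<beta>)"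
      unfolding I_def
      by (subst Bochner_Integration.integral_diff)
         (intro Bochner_Integration.integrable_sum int, rule integrable_mult_right, rule int,
          simp_all only: Bochner_Integration.integral_sum int integral_mult_right_zero)
    also have "\<dots> = (\<integral>P. data_prob P x * ((\<Sum>i\<in>UNIV. of_bool (x i j) - P j) - 2 * \<beta> * (P j - 1/2)) \<partial>beta_prior \<beta>)"
      unfolding sum_distrib_left[symmetric]
      by (rule Bochner_Integration.integral_cong) (simp_all add: algebra_simps)
    also have "\<dots> = 0" by (rule beta_fingerprinting) fact
    finally show ?thesis by simp
  qed
  have "(\<Sum>i\<in>UNIV. joint_expectation \<beta> M (\<lambda>P x y. \<Sum>j\<in>UNIV. y j * (of_bool (x i j) - P j)))
      = (\<Sum>i\<in>UNIV. \<Sum>x\<in>UNIV. \<Sum>j\<in>UNIV. (\<integral>y. y j \<partial>M x) * I x (\<lambda>P. of_bool (x i j) + (-1) * P j))"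
    using joint_expectation_linear(2)[OF assms, of "\<lambda>x j. of_bool (x _ j)" "-1"]
    unfolding I_def by simp
  also have "\<dots> = (\<Sum>x\<in>UNIV. \<Sum>j\<in>UNIV. (\<integral>y. y j \<partial>M x) * (\<Sum>i\<in>UNIV. I x (\<lambda>P. of_bool (x i j) + (-1) * P j)))"
    unfolding sum_distrib_left by (subst sum.swap) (intro sum.cong refl sum.swap)
  also have "\<dots> = 2 * \<beta> * (\<Sum>x\<in>UNIV. \<Sum>j\<in>UNIV. (\<integral>y. y j \<partial>M x) * I x (\<lambda>P. -1/2 + 1 * P j))"
    unfolding fp by (simp add: sum_distrib_left mult_ac)
  also have "(\<Sum>x\<in>UNIV. \<Sum>j\<in>UNIV. (\<integral>y. y j \<partial>M x) * I x (\<lambda>P. -1/2 + 1 * P j))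
      = joint_expectation \<beta> M (\<lambda>P x y. \<Sum>j\<in>UNIV. y j * (P j - 1/2))"
    using joint_expectation_linear(2)[OF assms, of "\<lambda>x j. -1/2" 1]
    unfolding I_def by simp
  finally show ?thesis .
qed

text \<open>Since \<open>s\<close> does not depend on \<open>P\<close>, the bound for fixed
  \<open>P\<close> integrates term by term against the prior.\<close>

lemma joint_row_correlation_bound:
  fixes M :: "('n::finite \<Rightarrow> 'd::finite \<Rightarrow> bool) \<Rightarrow> ('d \<Rightarrow> real) measure"
  assumes M: "randomized_alg M" and dp: "differentially_private \<epsilon> \<delta> M"
    and "0 < \<beta>" "0 \<le> \<epsilon>" "0 \<le> \<delta>" "0 < s"
  shows "joint_expectation \<beta> M (\<lambda>P x y. \<Sum>j\<in>UNIV. y j * (of_bool (x i j) - P j))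
    \<le> sinh \<epsilon> * (joint_expectation \<beta> M (\<lambda>P x y. \<Sum>j\<in>UNIV. (y j)\<^sup>2) / (8 * s) + s / 2)
      + \<delta> * real CARD('d) * (1 + exp (- \<epsilon>))"
proof -
  interpret prob_space "beta_prior \<beta> :: ('d \<Rightarrow> real) measure"
    using \<open>0 < \<beta>\<close> by (rule prob_space_beta_prior)
  define q where "q P = (\<Sum>x\<in>UNIV. data_prob P x * (\<integral>y. (\<Sum>j\<in>UNIV. (y j)\<^sup>2) \<partial>M x))" for P
  have q: "integrable (beta_prior \<beta>) q"
    unfolding q_def using integrable_data_prob[OF \<open>0 < \<beta>\<close>]
    by (intro Bochner_Integration.integrable_sum integrable_mult_left)
  have "joint_expectation \<beta> M (\<lambda>P x y. \<Sum>j\<in>UNIV. y j * (of_bool (x i j) - P j))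
     \<le> (\<integral>P. sinh \<epsilon> * (q P / (8 * s) + s / 2) + \<delta> * real CARD('d) * (1 + exp (- \<epsilon>)) \<partial>beta_prior \<beta>)"
    unfolding joint_expectation_def
  proof (rule integral_mono_AE)
    show "integrable (beta_prior \<beta>)
       (\<lambda>P. \<Sum>x\<in>UNIV. data_prob P x * (\<integral>y. (\<Sum>j\<in>UNIV. y j * (of_bool (x i j) - P j)) \<partial>M x))"
      using joint_expectation_linear(1)[OF M \<open>0 < \<beta>\<close>, of "\<lambda>x j. of_bool (x i j)" "-1"] by simp
    show "AE P in beta_prior \<beta>.
       (\<Sum>x\<in>UNIV. data_prob P x * (\<integral>y. (\<Sum>j\<in>UNIV. y j * (of_bool (x i j) - P j)) \<partial>M x))
       \<le> sinh \<epsilon> * (q P / (8 * s) + s / 2) + \<delta> * real CARD('d) * (1 + exp (- \<epsilon>))"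
      using AE_beta_prior[OF \<open>0 < \<beta>\<close>]
      by eventually_elim (unfold q_def, rule row_correlation_bound, use assms in \<open>auto intro: less_imp_le\<close>)
  qed (use q in auto)
  also have "\<dots> = sinh \<epsilon> * ((\<integral>P. q P \<partial>beta_prior \<beta>) / (8 * s) + s / 2) + \<delta> * real CARD('d) * (1 + exp (- \<epsilon>))"
    using q by (simp add: prob_space)
  finally show ?thesis unfolding joint_expectation_def q_def .
qed

section \<open>Comparison of the lower and upper bounds on the total correlation\<close>

theorem theorem3p1:
  fixes \<beta> \<gamma> k :: real
    and M :: "('n::finite \<Rightarrow> 'd::finite \<Rightarrow> bool) \<Rightarrow> ('d \<Rightarrow> real) measure"
  assumes "\<beta> > 0" "\<gamma> > 0" "k > 0"
    and "randomized_alg M"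
    and "differentially_private 1 (\<beta> * \<gamma> * k / (real CARD('n) * real CARD('d))) M"
    and "joint_expectation \<beta> M (\<lambda>P x y. \<Sum>j\<in>UNIV. (y j)\<^sup>2) = k"
    and "joint_expectation \<beta> M (\<lambda>P x y. \<Sum>j\<in>UNIV. y j * (P j - 1/2)) \<ge> \<gamma> * k"
  shows "real CARD('n) \<ge> \<gamma> * \<beta> * sqrt k"
proof -
  define n where "n = real CARD('n)"
  define e where "e = exp (1::real)"
  define r where "r = sqrt k"
  have pos: "n > 0" "e > 1" "r > 0" "k = r * r" "e \<le> 3"
    using \<open>k > 0\<close> exp_le by (auto simp: n_def e_def r_def)
  let ?J = "\<lambda>i. joint_expectation \<beta> M (\<lambda>P x y. \<Sum>j\<in>UNIV. y j * (of_bool (x i j) - P j))"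
  have "2 * \<beta> * (\<gamma> * k) \<le> (\<Sum>i\<in>UNIV. ?J i)"
    unfolding joint_fingerprinting[OF assms(4,1)] using assms by (intro mult_left_mono) auto
  also have "\<dots> \<le> (\<Sum>i\<in>(UNIV :: 'n set). sinh 1 * (r / 2) + \<beta> * \<gamma> * k / n * (1 + 1 / e))"
  proof (rule sum_mono)
    fix i
    \<comment> \<open>The choice \<open>s = r / 2\<close> minimises
      \<open>k / (8 * s) + s / 2\<close>, with minimum \<open>r / 2\<close>.\<close>
    have "?J i \<le> sinh 1 * (k / (8 * (r / 2)) + (r / 2) / 2)
        + \<beta> * \<gamma> * k / (real CARD('n) * real CARD('d)) * real CARD('d) * (1 + exp (- 1))"
      using joint_row_correlation_bound[OF assms(4,5,1), of "r / 2" i] assms(1-3,6) pos by simp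
    also have "\<dots> = sinh 1 * (r / 2) + \<beta> * \<gamma> * k / n * (1 + 1 / e)"
    proof -
      have "k / (8 * (r / 2)) + r / 2 / 2 = r / 2" using pos by (simp add: field_simps)
      moreover have "\<beta> * \<gamma> * k / (real CARD('n) * real CARD('d)) * real CARD('d) = \<beta> * \<gamma> * k / n"
        by (simp add: n_def)
      moreover have "exp (- 1) = 1 / e" by (simp add: e_def exp_minus inverse_eq_divide)
      ultimately show ?thesis by (simp only:)
    qed
    finally show "?J i \<le> sinh 1 * (r / 2) + \<beta> * \<gamma> * k / n * (1 + 1 / e)" .
  qed
  also have "\<dots> = n * (sinh 1 * (r / 2)) + \<beta> * \<gamma> * k * (1 + 1 / e)"
    using pos(1) by (simp add: n_def[symmetric] distrib_left)
  \<comment> \<open>The privacy errors of all rows together amount to \<open>1 + 1 / e\<close> times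
    \<open>\<beta> * \<gamma> * k\<close>; subtracted from the lower bound
    \<open>2 * \<beta> * \<gamma> * k\<close> they leave the factor
    \<open>1 - 1 / e\<close>.\<close>
  finally have "\<beta> * \<gamma> * k * (1 - 1 / e) \<le> n * (sinh 1 * (r / 2))"
    unfolding distrib_left right_diff_distrib by (simp add: mult_ac)
  also have "\<dots> \<le> n * ((1 - 1 / e) * r)"
  proof -
    have sinh: "sinh 1 = (e - 1 / e) / 2"
      by (simp add: sinh_def exp_minus e_def[symmetric] inverse_eq_divide)
    have "(1 - 1 / e) - sinh 1 / 2 = (e - 1) * (3 - e) / (4 * e)"
      unfolding sinh using pos(2) by (simp add: field_simps)
    moreover have "0 \<le> (e - 1) * (3 - e) / (4 * e)" using pos by simp
    ultimately have "sinh 1 / 2 \<le> 1 - 1 / e" by linarith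
    then have "sinh 1 / 2 * r \<le> (1 - 1 / e) * r"
      using pos by (intro mult_right_mono) auto
    then show ?thesis using pos by simp
  qed
  \<comment> \<open>One factor \<open>r\<close> of \<open>k = r * r\<close> is paired with
    \<open>1 - 1 / e\<close>, so that the same positive quantity can be cancelled on both
    sides.\<close>
  finally have "(\<gamma> * \<beta> * r) * ((1 - 1 / e) * r) \<le> n * ((1 - 1 / e) * r)"
    unfolding pos(4) by (simp add: mult_ac)
  moreover have "(1 - 1 / e) * r > 0" using pos by simp
  ultimately show ?thesis
    unfolding n_def r_def using mult_right_le_imp_le by blast
qed

end
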